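(* Let $p$ be a prime. The eigenvalues of the $(p-1)\times(p-1)$ matrix $M_{\Phi_p}^\dagger M_{\Phi_p}$ are $1$ with multiplicity $1$ and $p$ with multiplicity $p-2$.
   Context: For a monic polynomial $f\in\mathbb{Z}[x]$ of degree $m$ with distinct complex roots $\alpha_1,\dots,\alpha_m$, $M_f$ denotes the $m\times m$ Vandermonde matrix with $(i,j)$ entry $\alpha_i^{\,j-1}$, and $M_f^\dagger$ its conjugate transpose. $\Phi_p$ is the $p$-th cyclotomic polynomial $x^{p-1}+\cdots+x+1$. *)

theory Defs
  imports
    "HOL-Computational_Algebra.Primes"
    "Jordan_Normal_Form.Schur_Decomposition"
    "Jordan_Normal_Form.Spectral_Radius"
begin

definition root_enumeration :: "int poly \<Rightarrow> complex list \<Rightarrow> bool" where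
  "root_enumeration f as \<longleftrightarrow>
     distinct as \<and> set as = {z. poly (map_poly of_int f) z = 0}"

(* If as enumerates the roots of a monic f with distinct complex roots, then
   vandermonde_mat as is M_f for that ordering of the roots; indices are 0-based here,
   so the exponent is j instead of j - 1.  Reordering the roots permutes the rows. *)
definition vandermonde_mat :: "complex list \<Rightarrow> complex mat" where
  "vandermonde_mat as = mat (length as) (length as) (\<lambda>(i, j). as ! i ^ j)"

(* The formula x^(p-1) + ... + x + 1 is the p-th cyclotomic polynomial only for prime p. *)
definition cyclotomic_prime :: "nat \<Rightarrow> int poly" where
  "cyclotomic_prime p = (\<Sum>k<p. monom 1 k)"

definition alg_multiplicity :: "complex mat \<Rightarrow> complex \<Rightarrow> nat" where
  "alg_multiplicity A e = order e (char_poly A)"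

end

theory Submission
  imports Defs
begin

text \<open>Since the roots of \<open>\<Phi>\<^sub>p\<close> are the \<open>p\<close>-th roots of unity other than \<open>1\<close>, orthogonality
  of characters gives \<open>M\<^sup>\<dagger> M = p I - J\<close>, where \<open>J\<close> is the all-ones matrix. In the basis
  \<open>(1, \<dots>, 1), e\<^sub>2, \<dots>, e\<^sub>n\<close> the matrix \<open>J\<close> becomes upper triangular with diagonal
  \<open>n, 0, \<dots>, 0\<close>, which yields the characteristic polynomial for \<open>n = p - 1\<close>.\<close>

text \<open>The matrix is \<open>a\<close> I + \<open>b\<close> J. Reaching a triangular form rather
  than a diagonal one keeps the argument valid in every field, including characteristics dividing
  \<open>n\<close>, where J is nilpotent.\<close>

lemma char_poly_scalar_plus_const:
  fixes a b :: "'a :: field"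
  assumes n: "n > 0"
  shows "char_poly (mat n n (\<lambda>(i, j). (if i = j then a else 0) + b))
       = [:- (a + of_nat n * b), 1:] * [:- a, 1:] ^ (n - 1)"
proof -
  define A where "A = mat n n (\<lambda>(i, j). (if i = j then a else 0) + b)"
  \<comment> \<open>The columns of \<open>P\<close> are the all-ones vector followed by the
    remaining unit vectors; \<open>Q\<close> is its inverse.\<close>
  define P :: "'a mat" where "P = mat n n (\<lambda>(i, j). if j = 0 \<or> i = j then 1 else 0)"
  define Q :: "'a mat" where
    "Q = mat n n (\<lambda>(i, j). if i = j then 1 else if j = 0 then - 1 else 0)"
  \<comment> \<open>\<open>T\<close> is \<open>A\<close> in this basis: the all-ones vector u is an
    eigenvector for \<open>a + of_nat n * b\<close>, and each unit vector e is sent to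
    \<open>a\<close> e + \<open>b\<close> u.\<close>
  define T where "T = mat n n (\<lambda>(i, j).
    if i = 0 then (if j = 0 then a + of_nat n * b else b) else if i = j then a else 0)"
  have carrier: "A \<in> carrier_mat n n" "P \<in> carrier_mat n n" "Q \<in> carrier_mat n n"
    "T \<in> carrier_mat n n"
    by (simp_all add: A_def P_def Q_def T_def)
  have PQ: "P * Q = 1\<^sub>m n"
  proof (rule eq_matI)
    fix i j assume ij: "i < dim_row (1\<^sub>m n)" "j < dim_col (1\<^sub>m n)"
    have "(P * Q) $$ (i, j) = (\<Sum>k<n. P $$ (i, k) * Q $$ (k, j))"
      using ij carrier by (simp add: scalar_prod_def atLeast0LessThan)
    \<comment> \<open>Row \<open>i\<close> of \<open>P\<close> has ones exactly in columns 0 and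
      \<open>i\<close>, so two terms survive; the guard \<open>i = 0\<close> avoids counting them
      twice when they coincide.\<close>
    also have "\<dots> = (\<Sum>k<n. (if k = 0 then Q $$ (0, j) else 0)
        + (if k = i then (if i = 0 then 0 else Q $$ (i, j)) else 0))"
      using ij by (intro sum.cong) (auto simp: P_def)
    also have "\<dots> = Q $$ (0, j) + (if i = 0 then 0 else Q $$ (i, j))"
      using ij n by (simp add: sum.distrib)
    finally show "(P * Q) $$ (i, j) = 1\<^sub>m n $$ (i, j)"
      using ij n by (auto simp: Q_def)
  qed (use carrier in auto)
  have QP: "Q * P = 1\<^sub>m n"
    using mat_mult_left_right_inverse carrier(2,3) PQ by blast
  have AP: "A * P = P * T"
  proof (rule eq_matI)
    fix i j assume ij: "i < dim_row (P * T)" "j < dim_col (P * T)"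
    then have ij': "i < n" "j < n" using carrier by auto
    have "(A * P) $$ (i, j) = (\<Sum>k<n. A $$ (i, k) * P $$ (k, j))"
      using ij' carrier by (simp add: scalar_prod_def atLeast0LessThan)
    also have "\<dots> = (\<Sum>k<n. (if k = i then a * P $$ (i, j) else 0) + b * P $$ (k, j))"
      using ij' by (intro sum.cong) (auto simp: A_def algebra_simps)
    also have "\<dots> = a * P $$ (i, j) + b * (\<Sum>k<n. P $$ (k, j))"
      using ij' by (simp add: sum.distrib sum_distrib_left)
    also have "(\<Sum>k<n. P $$ (k, j)) = (\<Sum>k<n. if j = 0 then 1 else if k = j then 1 else 0)"
      using ij' by (intro sum.cong) (auto simp: P_def)
    also have "\<dots> = (if j = 0 then of_nat n else 1)"
      using ij' by simp
    finally have 1: "(A * P) $$ (i, j) = a * P $$ (i, j) + b * (if j = 0 then of_nat n else 1)" .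
    have "(P * T) $$ (i, j) = (\<Sum>k<n. P $$ (i, k) * T $$ (k, j))"
      using ij' carrier by (simp add: scalar_prod_def atLeast0LessThan)
    also have "\<dots> = (\<Sum>k<n. (if k = 0 then T $$ (0, j) else 0)
        + (if k = i then (if i = 0 then 0 else T $$ (i, j)) else 0))"
      using ij' by (intro sum.cong) (auto simp: P_def)
    also have "\<dots> = T $$ (0, j) + (if i = 0 then 0 else T $$ (i, j))"
      using ij' n by (simp add: sum.distrib)
    finally show "(A * P) $$ (i, j) = (P * T) $$ (i, j)"
      unfolding 1 using ij' n by (auto simp: P_def T_def algebra_simps)
  qed (use carrier in auto)
  have "A = A * (P * Q)" using carrier PQ by simp
  also have "\<dots> = P * T * Q" using carrier AP by (simp flip: assoc_mult_mat)
  finally have "similar_mat A T"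
    unfolding similar_mat_def similar_mat_wit_def
    using carrier PQ QP by (intro exI[of _ P] exI[of _ Q]) (auto simp: Let_def)
  then have "char_poly A = char_poly T"
    by (rule char_poly_similar)
  also have "\<dots> = (\<Prod>x\<leftarrow>diag_mat T. [:- x, 1:])"
    by (rule char_poly_upper_triangular[OF carrier(4)]) (auto simp: T_def)
  also have "diag_mat T = (a + of_nat n * b) # replicate (n - 1) a"
    using n by (intro nth_equalityI) (auto simp: diag_mat_def T_def nth_Cons')
  finally show ?thesis
    by (simp add: A_def)
qed

text \<open>For \<open>j = k\<close> every term is 1. Otherwise, multiplication by a root
  \<open>w\<close> permutes the roots of unity and scales the sum by
  \<open>cnj w ^ j * w ^ k\<close>; choosing \<open>w\<close> so that this factor is not 1 forces
  the sum to vanish.\<close>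

lemma sum_cnj_power_mult_power_roots_unity:
  assumes "j < n" "k < n"
  shows "(\<Sum>z | z ^ n = 1. cnj z ^ j * z ^ k) = (if j = k then of_nat n else 0)"
proof -
  let ?S = "{z :: complex. z ^ n = 1}"
  have n: "n > 0" using assms by simp
  have cnj: "cnj z * z = 1" if "z \<in> ?S" for z
  proof -
    have "norm z ^ n = 1 ^ n" using that by (simp flip: norm_power)
    then have "norm z = 1" using n by (subst (asm) power_eq_iff_eq_base) auto
    then show ?thesis by (metis complex_norm_square mult.commute of_real_1 one_power2)
  qed
  show ?thesis
  proof (cases "j = k")
    case True
    then have "(\<Sum>z\<in>?S. cnj z ^ j * z ^ k) = (\<Sum>z\<in>?S. 1)"
      by (intro sum.cong refl) (metis cnj power_mult_distrib power_one)
    then show ?thesis using True n by (simp add: card_roots_unity_eq)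
  next
    case False
    \<comment> \<open>By counting: if no root separated the exponents, all \<open>n\<close> roots of
      unity would satisfy \<open>w ^ d = 1\<close> with \<open>0 < d < n\<close>, an equation with
      only \<open>d\<close> solutions.\<close>
    have "\<exists>w\<in>?S. w ^ j \<noteq> w ^ k"
    proof (rule ccontr)
      assume "\<not> ?thesis"
      then have eq: "w ^ min j k = w ^ max j k" if "w \<in> ?S" for w
        using that by (auto simp: min_def max_def)
      define d where "d = max j k - min j k"
      have d: "0 < d" "d < n" "max j k = min j k + d"
        using assms False by (auto simp: d_def)
      have "?S \<subseteq> {w. w ^ d = 1}"
      proof
        fix w assume w: "w \<in> ?S"
        then have "w \<noteq> 0" using n by (auto simp: zero_power)
        then show "w \<in> {w. w ^ d = 1}" using eq[OF w] unfolding d(3) by (simp add: power_add)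
      qed
      then have "card ?S \<le> card {w :: complex. w ^ d = 1}"
        using d by (intro card_mono finite_roots_unity) auto
      then show False using d n by (simp add: card_roots_unity_eq)
    qed
    then obtain w where w: "w \<in> ?S" "w ^ j \<noteq> w ^ k" by blast
    have w0: "w \<noteq> 0" using w n by (auto simp: zero_power)
    let ?c = "cnj w ^ j * w ^ k"
    have "bij_betw ((*) w) ?S ?S"
      using w w0 by (intro bij_betw_byWitness[where f' = "\<lambda>z. z / w"])
        (auto simp: power_mult_distrib power_divide)
    then have "(\<Sum>z\<in>?S. cnj z ^ j * z ^ k) = (\<Sum>z\<in>?S. cnj (w * z) ^ j * (w * z) ^ k)"
      by (rule sum.reindex_bij_betw[symmetric])
    also have "\<dots> = ?c * (\<Sum>z\<in>?S. cnj z ^ j * z ^ k)"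
      by (simp add: sum_distrib_left power_mult_distrib mult_ac)
    finally have "(1 - ?c) * (\<Sum>z\<in>?S. cnj z ^ j * z ^ k) = 0"
      by (simp add: algebra_simps)
    moreover have "?c \<noteq> 1"
    proof
      assume "?c = 1"
      \<comment> \<open>Multiplying \<open>?c = 1\<close> by \<open>w ^ j\<close> and using that
        \<open>cnj w\<close> is the inverse of \<open>w\<close> gives \<open>w ^ j = w ^ k\<close>,
        against the choice of \<open>w\<close>.\<close>
      then have "w ^ j = (cnj w * w) ^ j * w ^ k"
        by (simp add: power_mult_distrib mult_ac)
      then show False using w cnj by simp
    qed
    ultimately show ?thesis using False by simp
  qed
qed

text \<open>Away from 1 the geometric sum equals (z^p - 1)/(z - 1); at 1 its value is
  \<open>p\<close>, which is nonzero.\<close>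

lemma roots_cyclotomic_prime:
  assumes "p > 0"
  shows "{z :: complex. poly (map_poly of_int (cyclotomic_prime p)) z = 0} = {z. z ^ p = 1} - {1}"
proof -
  have "map_poly of_int (cyclotomic_prime p) = (\<Sum>k<p. monom (1 :: complex) k)"
    by (simp add: cyclotomic_prime_def poly_eq_iff coeff_map_poly coeff_sum)
  then have "poly (map_poly of_int (cyclotomic_prime p)) z = (\<Sum>k<p. z ^ k)" for z :: complex
    by (simp add: poly_sum poly_monom)
  moreover have "(\<Sum>k<p. z ^ k) = 0 \<longleftrightarrow> z ^ p = 1 \<and> z \<noteq> 1" for z :: complex
    using assms by (cases "z = 1") (auto simp: geometric_sum)
  ultimately show ?thesis by auto
qed

text \<open>Each entry of the product is a sum over list positions, which distinctness puts in
  bijection with the roots; hence the product does not depend on their ordering.\<close>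

lemma adjoint_mult_vandermonde_mat:
  assumes "distinct as"
  shows "mat_adjoint (vandermonde_mat as) * vandermonde_mat as
       = mat (length as) (length as) (\<lambda>(i, j). \<Sum>z\<in>set as. cnj z ^ i * z ^ j)"
proof (rule eq_matI)
  let ?n = "length as" and ?M = "vandermonde_mat as"
  let ?R = "mat ?n ?n (\<lambda>(i, j). \<Sum>z\<in>set as. cnj z ^ i * z ^ j)"
  have M: "?M \<in> carrier_mat ?n ?n" by (simp add: vandermonde_mat_def)
  fix i j assume "i < dim_row ?R" "j < dim_col ?R"
  then have ij: "i < ?n" "j < ?n" by auto
  have "(mat_adjoint ?M * ?M) $$ (i, j) = (\<Sum>k<?n. cnj (as ! k) ^ i * as ! k ^ j)"
    using ij M by (simp add: scalar_prod_def atLeast0LessThan mat_adjoint_def vandermonde_mat_def)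
  also have "\<dots> = (\<Sum>z\<in>set as. cnj z ^ i * z ^ j)"
    using bij_betw_nth[OF assms refl refl] by (rule sum.reindex_bij_betw)
  finally show "(mat_adjoint ?M * ?M) $$ (i, j) = ?R $$ (i, j)"
    using ij by simp
qed (auto simp: vandermonde_mat_def mat_adjoint_def)

theorem theorem3:
  fixes p :: nat and as :: "complex list" and M A :: "complex mat"
  assumes "prime p"
    and "root_enumeration (cyclotomic_prime p) as"
  defines "M \<equiv> vandermonde_mat as"
  defines "A \<equiv> mat_adjoint M * M"
  shows "A \<in> carrier_mat (p - 1) (p - 1)
    \<and> spectrum A = (if p = 2 then {1} else {1, of_nat p})
    \<and> alg_multiplicity A 1 = 1
    \<and> alg_multiplicity A (of_nat p) = p - 2"
proof -
  have p: "p > 1" using assms(1) by (rule prime_gt_1_nat)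
  let ?S = "{z :: complex. z ^ p = 1}"
  have dist: "distinct as" and set: "set as = ?S - {1}"
    using assms(2) roots_cyclotomic_prime[of p] p by (auto simp: root_enumeration_def)
  have fin: "finite ?S" using p by (intro finite_roots_unity) auto
  have len: "length as = p - 1"
    using distinct_card[OF dist] p fin by (simp add: set card_roots_unity_eq)
  \<comment> \<open>The \<open>- 1\<close> is the term of the root 1, present in the full
    orthogonality sum but missing from \<open>set as\<close>.\<close>
  have "(\<Sum>z\<in>set as. cnj z ^ i * z ^ j) = (if i = j then of_nat p else 0) + (- 1)"
    if "i < p - 1" "j < p - 1" for i j
    using that sum_cnj_power_mult_power_roots_unity[of i p j] fin
    by (simp add: set sum_diff1)
  then have A: "A = mat (p - 1) (p - 1) (\<lambda>(i, j). (if i = j then of_nat p else 0) + (- 1))"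
    unfolding A_def M_def adjoint_mult_vandermonde_mat[OF dist] len
    by (intro cong_mat refl) simp
  then have carrier: "A \<in> carrier_mat (p - 1) (p - 1)" by simp
  \<comment> \<open>Here a = p, b = -1 and n = p - 1, so the simple eigenvalue a + n b is p - (p -
    1) = 1.\<close>
  have "char_poly A = [:- (of_nat p + of_nat (p - 1) * (- 1)), 1:] * [:- of_nat p, 1:] ^ (p - 1 - 1)"
    unfolding A using p by (intro char_poly_scalar_plus_const) simp
  then have char: "char_poly A = [:- 1, 1:] * [:- of_nat p, 1:] ^ (p - 2)"
    using p by (simp add: of_nat_diff numeral_2_eq_2)
  \<comment> \<open>Orders add over a product only when it is nonzero.\<close>
  have ne: "[:- 1, 1:] * [:- of_nat p, 1:] ^ (p - 2) \<noteq> (0 :: complex poly)"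
    unfolding mult_eq_0_iff power_eq_0_iff by simp
  have p1: "(of_nat p :: complex) \<noteq> 1" using p by simp
  have "spectrum A = {z. poly (char_poly A) z = 0}"
    by (auto simp: spectrum_def eigenvalue_root_char_poly[OF carrier])
  \<comment> \<open>For \<open>p = 2\<close> the exponent \<open>p - 2\<close> is 0, so the factor
    with root \<open>p\<close> disappears.\<close>
  then have "spectrum A = (if p = 2 then {1} else {1, of_nat p})"
    using p by (auto simp: char)
  moreover have "order 1 ([:- of_nat p, 1:] ^ (p - 2) :: complex poly) = 0"
    using p1 by (intro order_0I) simp
  then have "alg_multiplicity A 1 = 1"
    unfolding alg_multiplicity_def char order_mult[OF ne]
    using order_power_n_n[of "1 :: complex" 1] by simp
  moreover have "order (of_nat p :: complex) [:- 1, 1:] = 0"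
    using p1 by (intro order_0I) simp
  then have "alg_multiplicity A (of_nat p) = p - 2"
    unfolding alg_multiplicity_def char order_mult[OF ne]
    by (simp add: order_power_n_n)
  ultimately show ?thesis using carrier by blast
qed

end
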